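(* Let $L_{n,m}(x,y)$, $n,m\ge0$, be the bivariate Laguerre polynomials defined in the context, and let $L_k(x)=\sum_{j=0}^{k}\frac{k!}{j!}\binom{k}{k-j}(-x)^j$ denote the classical Laguerre polynomial with integer coefficients. For every fixed positive integer $k$: $$\sum_{n=0}^k\binom{k}{n}L_{n,k-n}(x,y)=2^kL_k\!\left(\frac{x+y}{2}\right),$$ $$\sum_{n=0}^k(-1)^{k-n}\binom{k}{n}L_{n,k-n}(x,y)=(y-x)^k,$$ $$\sum_{n=0}^k(-1)^{k-n}\binom{k}{n}L_{n,k-n}(-x,y)=(y+x)^k,$$ $$\sum_{n=0}^k x^{k-n}\binom{k}{n}L_{n,k-n}(x,1/x)=L_k(1)\,(1+x)^k,$$ where in the last two identities $x\neq0$ and $y\neq0$.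
   Context: Bivariate Laguerre polynomials: for $n,m\ge0$, $L_{n,m}(x,y)=e^{(x+y)/2}\,D^{\,n+m}\bigl(e^{-(x+y)/2}x^ny^m\bigr)$, where $D f(x,y)=\frac{\partial f}{\partial x}(x,y)+\frac{\partial f}{\partial y}(x,y)$; these are polynomials in $\mathbb{Z}[x,y]$ (e.g. $L_{1,0}(x,y)=1-x$, $L_{0,1}(x,y)=1-y$, $L_{1,1}(x,y)=2-2x-2y+xy$). Here $x,y$ are real (or complex) variables. *)

theory Defs
  imports "HOL-Analysis.Derivative"
begin

definition diag_deriv ::
    "('a \<Rightarrow> 'a \<Rightarrow> 'a) \<Rightarrow> 'a \<Rightarrow> 'a \<Rightarrow> 'a::real_normed_field" where
  "diag_deriv f x y = deriv (\<lambda>t. f t y) x + deriv (\<lambda>t. f x t) y"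

text \<open>
  The type class admits both the real and the complex numbers as the domain of the variables;
  over the complex numbers the partial derivatives are complex ones.
\<close>

definition biv_laguerre ::
    "nat \<Rightarrow> nat \<Rightarrow> 'a \<Rightarrow> 'a \<Rightarrow> 'a::{real_normed_field,banach}" where
  "biv_laguerre n m x y =
     exp ((x + y) / 2) *
     (diag_deriv ^^ (n + m)) (\<lambda>u v. exp (- ((u + v) / 2)) * u ^ n * v ^ m) x y"

text \<open>
  Normalised to have integer coefficients, i.e. \<open>k!\<close> times the usual Laguerre polynomial.
\<close>

definition laguerre :: "nat \<Rightarrow> 'a \<Rightarrow> 'a::field_char_0" where
  "laguerre k x = (\<Sum>j=0..k. fact k / fact j * of_nat (k choose (k - j)) * (- x) ^ j)"

end

theory Submission
  imports Defs
begin

text \<open>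
  By the binomial theorem, summing \<open>c\<^bsup>k-n\<^esup> x\<^sup>n y\<^bsup>k-n\<^esup>\<close> with binomial weights gives \<open>(x + c y)\<^sup>k\<close>. By linearity of \<open>D\<close> all four sums are therefore values of
  \<open>e\<^bsup>(x+y)/2\<^esup> D\<^sup>k (e\<^bsup>-(x+y)/2\<^esup> (x + c y)\<^sup>k)\<close>, and since \<open>D (x + c y) = 1 + c\<close> is constant,
  this is an explicit polynomial in \<open>1 + c\<close> and \<open>x + c y\<close>. The four identities are the cases
  \<open>c = 1, -1, -1, x\<close>.
\<close>

text \<open>
  \<open>diag_deriv\<close> is additive only where the partial derivatives exist; the following class of
  functions has them and is invariant under \<open>diag_deriv\<close>.
\<close>

inductive exp_poly :: "('a \<Rightarrow> 'a \<Rightarrow> 'a::{real_normed_field,banach}) \<Rightarrow> bool" where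
  monom: "exp_poly (\<lambda>u v. exp (- ((u + v) / 2)) * u ^ n * v ^ m)"
| add: "exp_poly f \<Longrightarrow> exp_poly g \<Longrightarrow> exp_poly (\<lambda>u v. f u v + g u v)"
| scale: "exp_poly f \<Longrightarrow> exp_poly (\<lambda>u v. c * f u v)"

lemma exp_poly_sum:
  assumes "finite A" "\<And>i. i \<in> A \<Longrightarrow> exp_poly (f i)"
  shows "exp_poly (\<lambda>u v. \<Sum>i\<in>A. f i u v)"
  using assms
proof (induction A rule: finite_induct)
  case empty
  \<comment> \<open>The zero function has no introduction rule of its own; it arises as 0 times the
    monomial with both exponents 0.\<close>
  show ?case using exp_poly.scale[OF exp_poly.monom[of 0 0], of 0] by simp
next
  case (insert i A)
  then show ?case using exp_poly.add[of "f i" "\<lambda>u v. \<Sum>i\<in>A. f i u v"] by simp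
qed

lemma exp_poly_differentiable:
  assumes "exp_poly f"
  shows "(\<lambda>t. f t y) field_differentiable (at x)"
    and "(\<lambda>t. f x t) field_differentiable (at y)"
proof -
  have "(\<forall>x y. (\<lambda>t. f t y) field_differentiable (at x)) \<and>
        (\<forall>x y. (\<lambda>t. f x t) field_differentiable (at y))"
    using assms
  proof induction
    case (monom n m)
    show ?case
      unfolding field_differentiable_def
      by (intro conjI allI exI; (rule derivative_eq_intros refl | simp)+)
  next
    case (add f g)
    then show ?case by (auto intro: field_differentiable_add)
  next
    case (scale f c)
    then show ?case by (auto intro: field_differentiable_mult field_differentiable_const)
  qed
  then show "(\<lambda>t. f t y) field_differentiable (at x)"
    "(\<lambda>t. f x t) field_differentiable (at y)" by blast+
qed

lemma diag_deriv_add: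
  assumes "exp_poly f" "exp_poly g"
  shows "diag_deriv (\<lambda>u v. f u v + g u v) = (\<lambda>u v. diag_deriv f u v + diag_deriv g u v)"
  by (intro ext) (simp add: diag_deriv_def exp_poly_differentiable assms)

lemma diag_deriv_scale:
  assumes "exp_poly f"
  shows "diag_deriv (\<lambda>u v. c * f u v) = (\<lambda>u v. c * diag_deriv f u v)"
  by (intro ext) (simp add: diag_deriv_def exp_poly_differentiable assms distrib_left)

text \<open>Each partial derivative of the exponential contributes -1/2, together the factor -1. The
  result is kept as a linear combination of generators of \<open>exp_poly\<close>, hence the literal
  \<open>(-1) *\<close>. At exponent 0 the truncated \<open>n - 1\<close> is harmless because its
  coefficient vanishes.\<close>

lemma diag_deriv_monom:
  fixes u v :: "'a::{real_normed_field,banach}"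
  shows "diag_deriv (\<lambda>u v. exp (- ((u + v) / 2)) * u ^ n * v ^ m) u v =
    of_nat n * (exp (- ((u + v) / 2)) * u ^ (n - 1) * v ^ m)
    + of_nat m * (exp (- ((u + v) / 2)) * u ^ n * v ^ (m - 1))
    + (-1) * (exp (- ((u + v) / 2)) * u ^ n * v ^ m)"
proof -
  let ?E = "exp (- ((u + v) / 2))"
  have 1: "deriv (\<lambda>t. exp (- ((t + v) / 2)) * t ^ n * v ^ m) u =
      (?E * (of_nat n * u ^ (n - 1)) - ?E / 2 * u ^ n) * v ^ m"
    by (rule DERIV_imp_deriv) (rule derivative_eq_intros refl | simp add: algebra_simps)+
  have 2: "deriv (\<lambda>t. exp (- ((u + t) / 2)) * u ^ n * t ^ m) v =
      (?E * (of_nat m * v ^ (m - 1)) - ?E / 2 * v ^ m) * u ^ n"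
    by (rule DERIV_imp_deriv) (rule derivative_eq_intros refl | simp add: algebra_simps)+
  show ?thesis
    unfolding diag_deriv_def 1 2 by (simp add: field_simps)
qed

lemma exp_poly_diag_deriv: "exp_poly f \<Longrightarrow> exp_poly (diag_deriv f)"
proof (induction rule: exp_poly.induct)
  case (monom n m)
  show ?case
    unfolding diag_deriv_monom[abs_def]
    by (intro exp_poly.add exp_poly.scale exp_poly.monom)
next
  case (add f g)
  then show ?case by (simp add: diag_deriv_add exp_poly.add)
next
  case (scale f c)
  then show ?case by (simp add: diag_deriv_scale exp_poly.scale)
qed

text \<open>The iterate is unfolded from the inside: one \<open>diag_deriv\<close> splits the sum,
  and both summands stay in \<open>exp_poly\<close>, so the induction hypothesis applies to
  them.\<close>

lemma funpow_diag_deriv_add: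
  "exp_poly f \<Longrightarrow> exp_poly g \<Longrightarrow> (diag_deriv ^^ N) (\<lambda>u v. f u v + g u v) =
     (\<lambda>u v. (diag_deriv ^^ N) f u v + (diag_deriv ^^ N) g u v)"
  by (induction N arbitrary: f g)
    (simp_all add: funpow_Suc_right diag_deriv_add exp_poly_diag_deriv del: funpow.simps(2))

lemma funpow_diag_deriv_scale:
  "exp_poly f \<Longrightarrow> (diag_deriv ^^ N) (\<lambda>u v. c * f u v) = (\<lambda>u v. c * (diag_deriv ^^ N) f u v)"
  by (induction N arbitrary: f)
    (simp_all add: funpow_Suc_right diag_deriv_scale exp_poly_diag_deriv del: funpow.simps(2))

lemma funpow_diag_deriv_sum:
  assumes "finite A" "\<And>i. i \<in> A \<Longrightarrow> exp_poly (f i)"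
  shows "(diag_deriv ^^ N) (\<lambda>u v. \<Sum>i\<in>A. f i u v) = (\<lambda>u v. \<Sum>i\<in>A. (diag_deriv ^^ N) (f i) u v)"
  using assms
proof (induction A rule: finite_induct)
  case empty
  show ?case
    using funpow_diag_deriv_scale[OF exp_poly.monom[of 0 0], of N 0] by simp
next
  case (insert i A)
  then show ?case
    using funpow_diag_deriv_add[of "f i" "\<lambda>u v. \<Sum>i\<in>A. f i u v"] by (simp add: exp_poly_sum)
qed

lemma exp_times_linear_power_eq_sum:
  fixes c :: "'a::{real_normed_field,banach}"
  shows "exp (- ((u + v) / 2)) * (u + c * v) ^ k =
    (\<Sum>n=0..k. c ^ (k - n) * of_nat (k choose n) * (exp (- ((u + v) / 2)) * u ^ n * v ^ (k - n)))"
  by (simp add: binomial_ring sum_distrib_left power_mult_distrib algebra_simps atMost_atLeast0)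

lemma exp_poly_linear_power:
  "exp_poly (\<lambda>u v. exp (- ((u + v) / 2)) * (u + c * v) ^ k)"
  unfolding exp_times_linear_power_eq_sum
  by (intro exp_poly_sum exp_poly.scale exp_poly.monom) simp

text \<open>On functions of w = u + c v the operator D acts as (1 + c) d/dw, so these weighted
  powers are closed under it up to linear combination. This yields a recursion that involves only k
  and k - 1.\<close>

lemma diag_deriv_linear_power:
  fixes c :: "'a::{real_normed_field,banach}"
  shows "diag_deriv (\<lambda>u v. exp (- ((u + v) / 2)) * (u + c * v) ^ k) =
    (\<lambda>u v. (of_nat k * (1 + c)) * (exp (- ((u + v) / 2)) * (u + c * v) ^ (k - 1))
           + (-1) * (exp (- ((u + v) / 2)) * (u + c * v) ^ k))"
proof (intro ext)
  fix u v :: 'a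
  let ?E = "exp (- ((u + v) / 2))" and ?w = "u + c * v"
  have 1: "deriv (\<lambda>t. exp (- ((t + v) / 2)) * (t + c * v) ^ k) u =
      ?E * (of_nat k * ?w ^ (k - 1)) - ?E / 2 * ?w ^ k"
    by (rule DERIV_imp_deriv) (rule derivative_eq_intros refl | simp add: algebra_simps)+
  have 2: "deriv (\<lambda>t. exp (- ((u + t) / 2)) * (u + c * t) ^ k) v =
      ?E * (of_nat k * c * ?w ^ (k - 1)) - ?E / 2 * ?w ^ k"
    by (rule DERIV_imp_deriv) (rule derivative_eq_intros refl | simp add: algebra_simps)+
  show "diag_deriv (\<lambda>u v. exp (- ((u + v) / 2)) * (u + c * v) ^ k) u v =
      (of_nat k * (1 + c)) * (?E * ?w ^ (k - 1)) + (-1) * (?E * ?w ^ k)"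
    unfolding diag_deriv_def 1 2 by (simp add: field_simps)
qed

text \<open>Pascal's rule in summed form: with S the shift of g, it reads (1 + S)^(N+1) = (1 + S)^N
  (1 + S), evaluated at index 0.\<close>

lemma sum_binomial_Suc:
  fixes g :: "nat \<Rightarrow> 'a::comm_semiring_1"
  shows "(\<Sum>j\<le>Suc N. of_nat (Suc N choose j) * g j) =
    (\<Sum>j\<le>N. of_nat (N choose j) * (g j + g (Suc j)))"
proof -
  have "(\<Sum>j\<le>Suc N. of_nat (Suc N choose j) * g j) =
      g 0 + (\<Sum>j\<le>N. of_nat (N choose Suc j) * g (Suc j)) + (\<Sum>j\<le>N. of_nat (N choose j) * g (Suc j))"
    by (subst sum.atMost_Suc_shift) (simp add: algebra_simps sum.distrib)
  also have "g 0 + (\<Sum>j\<le>N. of_nat (N choose Suc j) * g (Suc j)) =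
      (\<Sum>j\<le>Suc N. of_nat (N choose j) * g j)"
    by (subst sum.atMost_Suc_shift) simp
  also have "\<dots> = (\<Sum>j\<le>N. of_nat (N choose j) * g j)"
    by (simp add: binomial_eq_0)
  finally show ?thesis by (simp add: algebra_simps sum.distrib)
qed

text \<open>This is the Leibniz rule: N - j derivatives hit the exponential, giving (-1)^(N-j), and
  j hit the power, giving (1 + c)^j times the falling factorial j! (k choose j). Writing the sign as
  (-1)^N (-1)^j avoids the exponent N - j. Terms with j > k vanish through the binomial
  coefficient.\<close>

lemma funpow_diag_deriv_linear_power:
  fixes c :: "'a::{real_normed_field,banach}"
  shows "(diag_deriv ^^ N) (\<lambda>u v. exp (- ((u + v) / 2)) * (u + c * v) ^ k) =
    (\<lambda>u v. exp (- ((u + v) / 2)) * ((-1) ^ N *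
       (\<Sum>j\<le>N. of_nat (N choose j) *
          ((- (1 + c)) ^ j * of_nat (fact j * (k choose j)) * (u + c * v) ^ (k - j)))))"
proof (induction N arbitrary: k)
  case 0
  show ?case by simp
next
  case (Suc N)
  define a where "a k u v j = (- (1 + c)) ^ j * of_nat (fact j * (k choose j)) * (u + c * v) ^ (k - j)"
    for k j :: nat and u v
  \<comment> \<open>Absorption, (j+1) (k choose j+1) = k (k-1 choose j), turns a shift in j into a
    drop from k to k - 1; for k = 0 both sides vanish.\<close>
  have a_Suc: "a k u v (Suc j) = - (of_nat k * (1 + c)) * a (k - 1) u v j" for u v j
  proof -
    have "Suc j * (k choose Suc j) = k * ((k - 1) choose j)"
      by (cases k) (simp_all only: binomial_0_Suc Suc_times_binomial_eq diff_Suc_1 mult.commute mult_0 mult_0_right)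
    then have "fact (Suc j) * (k choose Suc j) = k * (fact j * ((k - 1) choose j))"
      by (metis fact_Suc mult.assoc mult.commute of_nat_id)
    then show ?thesis
      unfolding a_def by (simp del: of_nat_mult fact_Suc) (simp add: algebra_simps)
  qed
  \<comment> \<open>Pascal's rule and absorption reproduce, up to a global sign, the two terms of
    \<open>diag_deriv_linear_power\<close>; that sign takes (-1)^N to (-1)^(N+1).\<close>
  have step: "(\<Sum>j\<le>Suc N. of_nat (Suc N choose j) * a k u v j) =
      (\<Sum>j\<le>N. of_nat (N choose j) * a k u v j)
      - of_nat k * (1 + c) * (\<Sum>j\<le>N. of_nat (N choose j) * a (k - 1) u v j)" for u v
    unfolding sum_binomial_Suc a_Suc
    by (simp only: right_diff_distrib sum_subtractf sum_distrib_left mult_minus_left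
        mult.left_commute add_uminus_conv_diff)
  have IH: "(diag_deriv ^^ N) (\<lambda>u v. exp (- ((u + v) / 2)) * (u + c * v) ^ k) =
    (\<lambda>u v. exp (- ((u + v) / 2)) * ((-1) ^ N * (\<Sum>j\<le>N. of_nat (N choose j) * a k u v j)))" for k
    unfolding a_def by (rule Suc.IH)
  show ?case
    unfolding a_def[symmetric] step funpow_Suc_right o_def diag_deriv_linear_power
    by (subst funpow_diag_deriv_add; (intro exp_poly.scale exp_poly_linear_power)?)
      (simp only: funpow_diag_deriv_scale exp_poly_linear_power IH, simp add: algebra_simps)
qed

text \<open>For c \<noteq> -1 the right-hand side is (1 + c)^k L_k((x + c y) / (1 + c)). The
  homogenised form has no division by 1 + c and so covers c = -1 as well.\<close>

lemma sum_biv_laguerre: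
  fixes x y c :: "'a::{real_normed_field,banach}"
  shows "(\<Sum>n=0..k. c ^ (k - n) * of_nat (k choose n) * biv_laguerre n (k - n) x y) =
    (\<Sum>j=0..k. fact k / fact j * of_nat (k choose (k - j)) * (1 + c) ^ (k - j) * (- (x + c * y)) ^ j)"
proof -
  have "(\<Sum>n=0..k. c ^ (k - n) * of_nat (k choose n) * biv_laguerre n (k - n) x y) =
      exp ((x + y) / 2) * (diag_deriv ^^ k) (\<lambda>u v. \<Sum>n=0..k. c ^ (k - n) * of_nat (k choose n) *
        (exp (- ((u + v) / 2)) * u ^ n * v ^ (k - n))) x y"
    unfolding sum_distrib_left
    by (subst funpow_diag_deriv_sum)
      (auto simp: biv_laguerre_def funpow_diag_deriv_scale exp_poly.monom sum_distrib_left
        intro!: sum.cong exp_poly.scale)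
  also have "\<dots> = exp ((x + y) / 2) *
      (diag_deriv ^^ k) (\<lambda>u v. exp (- ((u + v) / 2)) * (u + c * v) ^ k) x y"
    by (simp only: exp_times_linear_power_eq_sum)
  also have "\<dots> = (-1) ^ k * (\<Sum>j\<le>k. of_nat (k choose j) *
          ((- (1 + c)) ^ j * of_nat (fact j * (k choose j)) * (x + c * y) ^ (k - j)))"
    unfolding funpow_diag_deriv_linear_power by (simp add: exp_minus)
  also have "\<dots> = (\<Sum>j\<le>k. fact k / fact (k - j) * of_nat (k choose j) * (1 + c) ^ j *
      (- (x + c * y)) ^ (k - j))"
    unfolding sum_distrib_left
  proof (rule sum.cong[OF refl])
    fix j assume "j \<in> {..k}"
    then have j: "j \<le> k" by simp
    have f: "of_nat (fact j * (k choose j)) = (fact k / fact (k - j) :: 'a)"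
      using j by (simp add: binomial_fact)
    have "(-1) ^ k = (-1) ^ j * (-1 :: 'a) ^ (k - j)"
      using j by (simp flip: power_add)
    then have s: "(-1) ^ k * ((- p) ^ j * w ^ (k - j)) = p ^ j * (- w) ^ (k - j)" for p w :: 'a
      unfolding power_minus[of p] power_minus[of w] by simp
    have "(-1) ^ k * (of_nat (k choose j) *
          ((- (1 + c)) ^ j * of_nat (fact j * (k choose j)) * (x + c * y) ^ (k - j))) =
        fact k / fact (k - j) * of_nat (k choose j) *
          ((-1) ^ k * ((- (1 + c)) ^ j * (x + c * y) ^ (k - j)))"
      unfolding f by (simp only: mult_ac)
    then show "(-1) ^ k * (of_nat (k choose j) *
          ((- (1 + c)) ^ j * of_nat (fact j * (k choose j)) * (x + c * y) ^ (k - j))) =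
        fact k / fact (k - j) * of_nat (k choose j) * (1 + c) ^ j * (- (x + c * y)) ^ (k - j)"
      unfolding s by (simp only: mult.assoc)
  qed
  also have "\<dots> = (\<Sum>j=0..k. fact k / fact j * of_nat (k choose (k - j)) * (1 + c) ^ (k - j) *
      (- (x + c * y)) ^ j)"
    \<comment> \<open>Reversing the order of summation matches the indexing in
      \<open>laguerre\<close>.\<close>
    by (rule sum.reindex_bij_witness[of _ "\<lambda>j. k - j" "\<lambda>j. k - j"]) auto
  finally show ?thesis .
qed

lemma sum_biv_laguerre_alternating:
  fixes x y :: "'a::{real_normed_field,banach}"
  shows "(\<Sum>n=0..k. (-1) ^ (k - n) * of_nat (k choose n) * biv_laguerre n (k - n) x y) = (y - x) ^ k"
proof -
  have "(\<Sum>n=0..k. (-1) ^ (k - n) * of_nat (k choose n) * biv_laguerre n (k - n) x y) =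
      (\<Sum>j=0..k. fact k / fact j * of_nat (k choose (k - j)) * (1 + (-1)) ^ (k - j) *
        (- (x + (-1) * y)) ^ j)"
    by (rule sum_biv_laguerre)
  \<comment> \<open>Since 1 + c = 0, only the term with exponent k - j = 0 survives.\<close>
  also have "\<dots> = (\<Sum>j=0..k. if j = k then (y - x) ^ k else 0)"
    by (intro sum.cong) (auto simp: power_0_left)
  finally show ?thesis by simp
qed

theorem theorem2:
  fixes k :: nat and x y :: "'a::{real_normed_field,banach}"
  assumes "k > 0"
  shows "(\<Sum>n=0..k. of_nat (k choose n) * biv_laguerre n (k - n) x y)
           = 2 ^ k * laguerre k ((x + y) / 2)
       \<and> (\<Sum>n=0..k. (-1) ^ (k - n) * of_nat (k choose n) * biv_laguerre n (k - n) x y)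
           = (y - x) ^ k
       \<and> (x \<noteq> 0 \<and> y \<noteq> 0 \<longrightarrow>
           (\<Sum>n=0..k. (-1) ^ (k - n) * of_nat (k choose n) * biv_laguerre n (k - n) (- x) y)
             = (y + x) ^ k)
       \<and> (x \<noteq> 0 \<longrightarrow>
           (\<Sum>n=0..k. x ^ (k - n) * of_nat (k choose n) * biv_laguerre n (k - n) x (1 / x))
             = laguerre k 1 * (1 + x) ^ k)"
proof (intro conjI impI)
  \<comment> \<open>With c = 1, the 2^j missing from 2^k is drawn out of (x + y)^j, which halves the
    argument.\<close>
  have "2 ^ (k - j) * (- (x + y)) ^ j = 2 ^ k * (- ((x + y) / 2)) ^ j" if "j \<le> k" for j
  proof -
    have "2 ^ k = (2 :: 'a) ^ (k - j) * 2 ^ j"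
      using that by (simp flip: power_add)
    moreover have "(- (x + y)) ^ j = 2 ^ j * (- ((x + y) / 2)) ^ j"
      unfolding power_mult_distrib[symmetric] by (rule arg_cong[of _ _ "\<lambda>z. z ^ j"]) (simp add: field_simps)
    ultimately show ?thesis by (simp only: mult.assoc)
  qed
  then have "(\<Sum>j=0..k. fact k / fact j * of_nat (k choose (k - j)) * (1 + 1) ^ (k - j) *
      (- (x + 1 * y)) ^ j) = 2 ^ k * laguerre k ((x + y) / 2)"
    unfolding laguerre_def sum_distrib_left by (intro sum.cong) (simp_all add: mult_ac)
  then show "(\<Sum>n=0..k. of_nat (k choose n) * biv_laguerre n (k - n) x y)
      = 2 ^ k * laguerre k ((x + y) / 2)"
    using sum_biv_laguerre[where c = 1, of k x y] by simp
next
  show "(\<Sum>n=0..k. (-1) ^ (k - n) * of_nat (k choose n) * biv_laguerre n (k - n) x y) = (y - x) ^ k"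
    by (rule sum_biv_laguerre_alternating)
next
  show "(\<Sum>n=0..k. (-1) ^ (k - n) * of_nat (k choose n) * biv_laguerre n (k - n) (- x) y) = (y + x) ^ k"
    using sum_biv_laguerre_alternating[of k "- x" y] by simp
next
  assume "x \<noteq> 0"
  \<comment> \<open>For c = x and y = 1/x both x + c y and 1 + c equal 1 + x, so their powers merge
    and the remaining signs give L_k(1).\<close>
  have "(1 + x) ^ (k - j) * (- (x + x * (1 / x))) ^ j = (-1) ^ j * (1 + x) ^ k" if "j \<le> k" for j
  proof -
    have "(- (x + x * (1 / x))) ^ j = (-1) ^ j * (1 + x) ^ j"
      using \<open>x \<noteq> 0\<close> power_minus[of "1 + x" j] by (simp add: add.commute)
    moreover have "(1 + x) ^ k = (1 + x) ^ (k - j) * (1 + x) ^ j"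
      using that by (simp flip: power_add)
    ultimately show ?thesis by simp
  qed
  then show "(\<Sum>n=0..k. x ^ (k - n) * of_nat (k choose n) * biv_laguerre n (k - n) x (1 / x))
      = laguerre k 1 * (1 + x) ^ k"
    unfolding sum_biv_laguerre laguerre_def sum_distrib_right
    by (intro sum.cong) (simp_all only: mult.assoc atLeastAtMost_iff)
qed

end
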